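(* Let $\alpha\in(0,1]$ and let $\mathfrak{w},\nu:[0,\infty)\to\Omega$ be $\alpha_{gH}$-differentiable (with base point $0$) at a point $\tau>0$. Then: (1) if $\mathfrak{w}$ and $\nu$ are $\alpha_{i.gH}$-differentiable at $\tau$, then ${}_{i.gH}\mathbf{T}_{\alpha}^0[\mathfrak{w}(\tau)\oplus\nu(\tau)]={}_{i.gH}\mathbf{T}_{\alpha}^0(\mathfrak{w}(\tau))\oplus{}_{i.gH}\mathbf{T}_{\alpha}^0(\nu(\tau))$; (2) if $\mathfrak{w}$ and $\nu$ are $\alpha_{ii.gH}$-differentiable at $\tau$, then ${}_{ii.gH}\mathbf{T}_{\alpha}^0[\mathfrak{w}(\tau)\oplus\nu(\tau)]={}_{ii.gH}\mathbf{T}_{\alpha}^0(\mathfrak{w}(\tau))\oplus{}_{ii.gH}\mathbf{T}_{\alpha}^0(\nu(\tau))$.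
   Context: A fuzzy number is a map $\mathcal{P}:\mathbb{R}\to[0,1]$ that is normal, fuzzy convex, upper semicontinuous and compactly supported; $\mathcal{F}$ is the set of fuzzy numbers. For $r\in(0,1]$, $[\mathcal{P}]^r=\{x:\mathcal{P}(x)\ge r\}$, and $[\mathcal{P}]^0=\overline{\{x:\mathcal{P}(x)>0\}}$; each $[\mathcal{P}]^r=[\mathcal{P}_1(r),\mathcal{P}_2(r)]$ is a compact interval. Addition $\oplus$ and multiplication by real scalars are levelwise: $[\mathcal{P}\oplus\mathcal{Q}]^r=[\mathcal{P}]^r+[\mathcal{Q}]^r$, $[c\,\mathcal{P}]^r=c[\mathcal{P}]^r$. $\Omega\subset\mathcal{F}$ is the set of triangular fuzzy numbers $(p_1,p_2,p_3)$, $p_1\le p_2\le p_3$, with $r$-cuts $[p_1+r(p_2-p_1),\,p_3-r(p_3-p_2)]$. A function with values in $\Omega$ is written $\mathfrak{w}=(\mathfrak{w}_1,\mathfrak{w}_2,\mathfrak{w}_3)$ with real-valued $\mathfrak{w}_i$. The generalized Hukuhara difference $\mathcal{P}\ominus_{gH}\mathcal{Q}$ is the fuzzy number $\mathcal{R}$ (if it exists) such that $\mathcal{P}=\mathcal{Q}\oplus\mathcal{R}$ or $\mathcal{Q}=\mathcal{P}\oplus(-1)\mathcal{R}$. Standing assumption: the gH-differences that occur exist and belong to $\Omega$. Limits are taken in the Hausdorff metric $D(\mathcal{P},\mathcal{Q})=\sup_{r\in[0,1]}\max\{|\mathcal{P}_1(r)-\mathcal{Q}_1(r)|,|\mathcal{P}_2(r)-\mathcal{Q}_2(r)|\}$.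 $\mathfrak{w}$ is $\alpha_{gH}$-differentiable at $\tau>0$ if ${}_{gH}\mathbf{T}^{0}_{\alpha}(\mathfrak{w}(\tau))=\lim_{\epsilon\to0}\frac{\mathfrak{w}(\tau+\epsilon\tau^{1-\alpha})\ominus_{gH}\mathfrak{w}(\tau)}{\epsilon}$ exists in $\mathcal{F}$. For real-valued $f$, $T^0_\alpha f(\tau)=\lim_{\epsilon\to0}\frac{f(\tau+\epsilon\tau^{1-\alpha})-f(\tau)}{\epsilon}$. An $\alpha_{gH}$-differentiable $\mathfrak{w}$ is $\alpha_{i.gH}$-differentiable at $\tau$ if its derivative there, then written ${}_{i.gH}\mathbf{T}^{0}_{\alpha}(\mathfrak{w}(\tau))$, equals $(T^0_\alpha\mathfrak{w}_1(\tau),T^0_\alpha\mathfrak{w}_2(\tau),T^0_\alpha\mathfrak{w}_3(\tau))$, and $\alpha_{ii.gH}$-differentiable at $\tau$ if its derivative there, then written ${}_{ii.gH}\mathbf{T}^{0}_{\alpha}(\mathfrak{w}(\tau))$, equals $(T^0_\alpha\mathfrak{w}_3(\tau),T^0_\alpha\mathfrak{w}_2(\tau),T^0_\alpha\mathfrak{w}_1(\tau))$. *)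

theory Defs
  imports "HOL-Analysis.Analysis"
begin

section \<open>Fuzzy numbers\<close>

text \<open>Upper semicontinuity is written out for real functions: \<open>limsup\<close> of \<open>P\<close> at
  \<open>x\<close> is at most \<open>P x\<close>.\<close>

definition upper_semicontinuous :: "(real \<Rightarrow> real) \<Rightarrow> bool" where
  "upper_semicontinuous P \<longleftrightarrow> (\<forall>x. \<forall>y > P x. \<forall>\<^sub>F z in nhds x. P z < y)"

definition is_fuzzy_number :: "(real \<Rightarrow> real) \<Rightarrow> bool" where
  "is_fuzzy_number P \<longleftrightarrow>
     (\<forall>x. 0 \<le> P x \<and> P x \<le> 1) \<and>
     (\<exists>x. P x = 1) \<and>
     (\<forall>x y t. 0 \<le> t \<and> t \<le> 1 \<longrightarrow> P (t * x + (1 - t) * y) \<ge> min (P x) (P y)) \<and>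
     upper_semicontinuous P \<and>
     compact (closure {x. P x > 0})"

typedef fuzzy = "{P. is_fuzzy_number P}" morphisms memb Abs_fuzzy
proof -
  have "upper_semicontinuous (\<lambda>x. if x = 0 then 1 else 0)"
    unfolding upper_semicontinuous_def
  proof (intro allI impI)
    fix x y :: real
    assume y: "y > (if x = 0 then 1 else 0)"
    show "\<forall>\<^sub>F z in nhds x. (if z = 0 then 1 else 0) < y"
    proof (cases "x = 0")
      case True
      then show ?thesis using y by (intro always_eventually) auto
    next
      case False
      have "\<forall>\<^sub>F z in nhds x. z \<in> - {0}"
        using False by (intro eventually_nhds_in_open) auto
      then show ?thesis by eventually_elim (use y False in auto)
    qed
  qed
  then have "is_fuzzy_number (\<lambda>x. if x = 0 then 1 else 0)"
    by (auto simp: is_fuzzy_number_def min_def)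
  then show ?thesis by blast
qed

definition rcut :: "fuzzy \<Rightarrow> real \<Rightarrow> real set" where
  "rcut P r = (if r = 0 then closure {x. memb P x > 0} else {x. memb P x \<ge> r})"

definition lower :: "fuzzy \<Rightarrow> real \<Rightarrow> real" where
  "lower P r = Inf (rcut P r)"

definition upper :: "fuzzy \<Rightarrow> real \<Rightarrow> real" where
  "upper P r = Sup (rcut P r)"

text \<open>\<open>rcut_fadd\<close> and \<open>rcut_fscale\<close> below show that the fuzzy numbers described
  levelwise here exist; they are unique by \<open>fuzzy_eqI\<close>.\<close>

definition fadd :: "fuzzy \<Rightarrow> fuzzy \<Rightarrow> fuzzy" (infixl "\<oplus>\<^sub>f" 65) where
  "P \<oplus>\<^sub>f Q = (THE R. \<forall>r\<in>{0..1}. rcut R r = {x + y |x y. x \<in> rcut P r \<and> y \<in> rcut Q r})"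

definition fscale :: "real \<Rightarrow> fuzzy \<Rightarrow> fuzzy" (infixr "\<cdot>\<^sub>f" 75) where
  "c \<cdot>\<^sub>f P = (THE R. \<forall>r\<in>{0..1}. rcut R r = (\<lambda>x. c * x) ` rcut P r)"

text \<open>The Hausdorff metric \<open>D\<close>; all level sets lie in the compact \<open>0\<close>-cut, so the
  supremum is over a bounded set.\<close>

definition fdist :: "fuzzy \<Rightarrow> fuzzy \<Rightarrow> real" where
  "fdist P Q =
     (SUP r\<in>{0..1}. max \<bar>lower P r - lower Q r\<bar> \<bar>upper P r - upper Q r\<bar>)"

lemma is_fuzzy_memb: "is_fuzzy_number (memb P)"
  using memb[of P] by simp

lemma fuzzy_eqI:
  assumes "\<And>r. 0 < r \<Longrightarrow> r \<le> 1 \<Longrightarrow> rcut P r = rcut Q r"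
  shows "P = Q"
proof -
  have le: "memb P x \<le> memb Q x" if *: "\<And>r. 0 < r \<Longrightarrow> r \<le> 1 \<Longrightarrow> rcut P r = rcut Q r" for P Q x
  proof (cases "memb P x > 0")
    case True
    moreover have "memb P x \<le> 1" using is_fuzzy_memb[of P] by (simp add: is_fuzzy_number_def)
    ultimately have "x \<in> rcut Q (memb P x)" using *[of "memb P x"] by (auto simp: rcut_def)
    then show ?thesis using True by (simp add: rcut_def)
  next
    case False
    moreover have "memb Q x \<ge> 0" using is_fuzzy_memb[of Q] by (simp add: is_fuzzy_number_def)
    ultimately show ?thesis by simp
  qed
  have "memb P = memb Q"
    using le[of P Q] le[of Q P] assms by (intro ext antisym) auto
  then show ?thesis by (simp add: memb_inject)
qed

lemma rcut_mono:
  assumes "0 < s" "s \<le> r" shows "rcut P r \<subseteq> rcut P s"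
  using assms by (auto simp: rcut_def)

lemma rcut_subset_0: "0 < r \<Longrightarrow> rcut P r \<subseteq> rcut P 0"
  using closure_subset by (fastforce simp: rcut_def)

lemma usc_closed: "upper_semicontinuous P \<longleftrightarrow> (\<forall>r. closed {x. P x \<ge> r})"
proof
  assume "\<forall>r. closed {x. P x \<ge> r}"
  then have "open {z. P z < y}" for y
    by (simp add: closed_def Compl_eq not_le)
  then show "upper_semicontinuous P"
    unfolding upper_semicontinuous_def eventually_nhds by blast
next
  assume *: "upper_semicontinuous P"
  have "open {x. P x < r}" for r
    unfolding open_subopen[of "{x. P x < r}"]
  proof
    fix x assume "x \<in> {x. P x < r}"
    then obtain T where "open T" "x \<in> T" "\<forall>z\<in>T. P z < r"
      using * unfolding upper_semicontinuous_def eventually_nhds by blast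
    then show "\<exists>T. open T \<and> x \<in> T \<and> T \<subseteq> {x. P x < r}" by blast
  qed
  then show "\<forall>r. closed {x. P x \<ge> r}"
    by (simp add: closed_def Compl_eq not_le)
qed

lemma rcut_compact: "0 \<le> r \<Longrightarrow> compact (rcut P r)"
proof (cases "r = 0")
  case False
  assume "0 \<le> r"
  have "compact (rcut P 0)" using is_fuzzy_memb[of P] by (simp add: is_fuzzy_number_def rcut_def)
  moreover have "closed (rcut P r)"
    using is_fuzzy_memb[of P] False by (simp add: is_fuzzy_number_def rcut_def usc_closed)
  moreover have "rcut P r \<subseteq> rcut P 0" using rcut_subset_0 False \<open>0 \<le> r\<close> by simp
  ultimately show ?thesis using compact_Int_closed[of "rcut P 0" "rcut P r"]
    by (simp add: Int_absorb1)
qed (use is_fuzzy_memb[of P] in \<open>simp add: is_fuzzy_number_def rcut_def\<close>)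

lemma rcut_convex: "0 \<le> r \<Longrightarrow> convex (rcut P r)"
proof -
  assume "0 \<le> r"
  have m: "memb P (t * x + (1 - t) * y) \<ge> min (memb P x) (memb P y)" if "0 \<le> t" "t \<le> 1" for t x y
    using is_fuzzy_memb[of P] that by (simp add: is_fuzzy_number_def)
  have m': "memb P (u * x + v * y) \<ge> min (memb P x) (memb P y)" if "0 \<le> u" "0 \<le> v" "u + v = 1" for u v x y
    
  proof -
    have "v = 1 - u" "u \<le> 1" using that by auto
    then show ?thesis using m[of u x y] that(1) by simp
  qed
  have "convex {x. memb P x > 0}"
    unfolding convex_def
  proof (clarify)
    fix x y u v :: real
    assume "0 < memb P x" "0 < memb P y" "0 \<le> u" "0 \<le> v" "u + v = 1"
    then show "0 < memb P (u *\<^sub>R x + v *\<^sub>R y)" using m'[of u v x y] by simp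
  qed
  moreover have "convex {x. memb P x \<ge> r}"
    unfolding convex_def
  proof (clarify)
    fix x y u v :: real
    assume "r \<le> memb P x" "r \<le> memb P y" "0 \<le> u" "0 \<le> v" "u + v = 1"
    then show "r \<le> memb P (u *\<^sub>R x + v *\<^sub>R y)" using m'[of u v x y] by simp
  qed
  ultimately show ?thesis by (simp add: rcut_def convex_closure)
qed

lemma rcut_nonempty: "0 \<le> r \<Longrightarrow> r \<le> 1 \<Longrightarrow> rcut P r \<noteq> {}"
proof -
  assume r: "0 \<le> r" "r \<le> 1"
  obtain x where "memb P x = 1" using is_fuzzy_memb[of P] by (auto simp: is_fuzzy_number_def)
  then have "x \<in> rcut P r" using r closure_subset[of "{x. memb P x > 0}"] by (auto simp: rcut_def)
  then show ?thesis by auto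
qed

lemma rcut_0_eq: "rcut P 0 = closure (\<Union>r\<in>{0<..1}. rcut P r)"
proof -
  have "{x. memb P x > 0} = (\<Union>r\<in>{0<..1}. rcut P r)"
    using is_fuzzy_memb[of P] by (force simp: is_fuzzy_number_def rcut_def)
  then show ?thesis by (simp add: rcut_def)
qed

lemma fuzzy_of_levels:
  fixes A :: "real \<Rightarrow> real set"
  assumes comp: "\<And>r. 0 < r \<Longrightarrow> r \<le> 1 \<Longrightarrow> compact (A r)"
    and conv: "\<And>r. 0 < r \<Longrightarrow> r \<le> 1 \<Longrightarrow> convex (A r)"
    and ne: "A 1 \<noteq> {}"
    and mono: "\<And>r s. 0 < s \<Longrightarrow> s \<le> r \<Longrightarrow> r \<le> 1 \<Longrightarrow> A r \<subseteq> A s"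
    and left: "\<And>r x. 0 < r \<Longrightarrow> r \<le> 1 \<Longrightarrow> (\<And>s. 0 < s \<Longrightarrow> s < r \<Longrightarrow> x \<in> A s) \<Longrightarrow> x \<in> A r"
    and zero: "A 0 = closure (\<Union>r\<in>{0<..1}. A r)"
    and bdd: "bounded (A 0)"
  shows "\<exists>P. \<forall>r\<in>{0..1}. rcut P r = A r"
proof -
  define S where "S x = insert 0 {r. 0 < r \<and> r \<le> 1 \<and> x \<in> A r}" for x
  define P where "P x = Sup (S x)" for x
  have bS: "bdd_above (S x)" for x by (rule bdd_aboveI[of _ 1]) (auto simp: S_def)
  have P0: "0 \<le> P x" for x unfolding P_def by (rule cSup_upper[OF _ bS]) (simp add: S_def)
  have P1: "P x \<le> 1" for x unfolding P_def by (rule cSup_least) (auto simp: S_def)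
  have lev: "{x. P x \<ge> r} = A r" if r: "0 < r" "r \<le> 1" for r
  proof safe
    fix x assume "x \<in> A r"
    then show "r \<le> P x" unfolding P_def by (intro cSup_upper[OF _ bS]) (use r in \<open>simp add: S_def\<close>)
  next
    fix x assume x: "r \<le> P x"
    show "x \<in> A r"
    proof (rule left[OF r])
      fix s assume s: "0 < s" "s < r"
      then have "s < Sup (S x)" using x by (simp add: P_def)
      then obtain t where "t \<in> S x" "s < t"
        using less_cSup_iff[OF _ bS, of x s] by (auto simp: S_def)
      then show "x \<in> A s" using s mono[of s t] by (auto simp: S_def)
    qed
  qed
  have lev': "x \<in> A r \<longleftrightarrow> r \<le> P x" if "0 < r" "r \<le> 1" for x r
    using lev[OF that] by blast
  have pos: "{x. P x > 0} = (\<Union>r\<in>{0<..1}. A r)"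
  proof safe
    fix x assume "0 < P x"
    then show "x \<in> (\<Union>r\<in>{0<..1}. A r)" using lev'[of "P x" x] P1[of x] by force
  next
    fix x r assume "r \<in> {0<..1::real}" "x \<in> A r"
    then have "r \<le> P x" using lev'[of r x] by simp
    then show "0 < P x" using \<open>r \<in> {0<..1}\<close> by simp
  qed
  have "is_fuzzy_number P"
    unfolding is_fuzzy_number_def
  proof (intro conjI allI impI)
    fix x show "0 \<le> P x" "P x \<le> 1" using P0 P1 by auto
  next
    show "\<exists>x. P x = 1" using ne lev'[of 1] P1 by (metis antisym ex_in_conv order_refl zero_less_one)
  next
    fix x y t :: real assume t: "0 \<le> t \<and> t \<le> 1"
    define m where "m = min (P x) (P y)"
    show "m \<le> P (t * x + (1 - t) * y)"
    proof (cases "m > 0")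
      case True
      have m1: "m \<le> 1" using P1[of x] by (simp add: m_def)
      have "x \<in> A m" "y \<in> A m" by (simp_all add: lev'[OF True m1]) (simp_all add: m_def)
      then have "t * x + (1 - t) * y \<in> A m"
        using convexD[OF conv[OF True m1], of x y t "1 - t"] t by simp
      then show ?thesis by (simp add: lev'[OF True m1])
    next
      case False
      then show ?thesis using P0[of "t * x + (1 - t) * y"] by linarith
    qed
  next
    have "closed {x. P x \<ge> r}" for r
    proof -
      consider "r \<le> 0" | "0 < r" "r \<le> 1" | "r > 1" by linarith
      then show ?thesis
      proof cases
        case 1
        then have "{x. P x \<ge> r} = UNIV" by (auto intro: order_trans[OF _ P0])
        then show ?thesis by simp
      next
        case 2
        then show ?thesis using lev[OF 2] compact_imp_closed[OF comp[OF 2]] by simp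
      next
        case 3
        then have "{x. P x \<ge> r} = {}" by (auto simp: not_le intro: le_less_trans[OF P1])
        then show ?thesis by (metis closed_empty)
      qed
    qed
    then show "upper_semicontinuous P" by (simp add: usc_closed)
  next
    show "compact (closure {x. 0 < P x})"
      using bdd zero by (simp add: pos compact_eq_bounded_closed)
  qed
  then have memb: "memb (Abs_fuzzy P) = P" by (simp add: Abs_fuzzy_inverse)
  show ?thesis
  proof (intro exI ballI)
    fix r :: real assume "r \<in> {0..1}"
    then show "rcut (Abs_fuzzy P) r = A r"
      using lev[of r] by (cases "r = 0") (simp_all add: rcut_def memb pos zero)
  qed
qed

lemma rcut_fadd:
  assumes "0 \<le> r" "r \<le> 1"
  shows "rcut (P \<oplus>\<^sub>f Q) r = {x + y |x y. x \<in> rcut P r \<and> y \<in> rcut Q r}"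
proof -
  define A where "A r = {x + y |x y. x \<in> rcut P r \<and> y \<in> rcut Q r}" for r
  have comp: "compact (A r)" if "0 \<le> r" for r
    unfolding A_def by (intro compact_sums rcut_compact that)
  have z: "A 0 = closure (\<Union>r\<in>{0<..1}. A r)"
  proof
    show "closure (\<Union>r\<in>{0<..1}. A r) \<subseteq> A 0"
    proof (rule closure_minimal)
      show "closed (A 0)" using comp compact_imp_closed by auto
      show "(\<Union>r\<in>{0<..1}. A r) \<subseteq> A 0"
        
      proof (rule UN_least)
        fix r :: real assume "r \<in> {0<..1}"
        then have "rcut P r \<subseteq> rcut P 0" "rcut Q r \<subseteq> rcut Q 0" by (simp_all add: rcut_subset_0)
        then show "A r \<subseteq> A 0" unfolding A_def by blast
      qed
    qed
  next
    show "A 0 \<subseteq> closure (\<Union>r\<in>{0<..1}. A r)"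
    proof
      fix z assume "z \<in> A 0"
      then obtain x y where xy: "x \<in> rcut P 0" "y \<in> rcut Q 0" "z = x + y" by (auto simp: A_def)
      obtain f where f: "\<And>n. memb P (f n) > 0" "f \<longlonglongrightarrow> x"
        using xy(1) by (auto simp: rcut_def closure_sequential)
      obtain g where g: "\<And>n. memb Q (g n) > 0" "g \<longlonglongrightarrow> y"
        using xy(2) by (auto simp: rcut_def closure_sequential)
      have "f n + g n \<in> (\<Union>r\<in>{0<..1}. A r)" for n
      proof
        let ?m = "min (memb P (f n)) (memb Q (g n))"
        have "memb P (f n) \<le> 1" using is_fuzzy_memb[of P] by (simp add: is_fuzzy_number_def)
        then show "?m \<in> {0<..1}" using f(1)[of n] g(1)[of n] by auto
        then have "f n \<in> rcut P ?m" "g n \<in> rcut Q ?m" using f(1)[of n] g(1)[of n]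
          by (simp_all add: rcut_def min_def)
        then show "f n + g n \<in> A ?m" unfolding A_def by blast
      qed
      moreover have "(\<lambda>n. f n + g n) \<longlonglongrightarrow> z" using f(2) g(2) xy(3) by (auto intro: tendsto_add)
      ultimately show "z \<in> closure (\<Union>r\<in>{0<..1}. A r)"
        unfolding closure_sequential by (intro exI[of _ "\<lambda>n. f n + g n"]) simp
    qed
  qed
  have "\<exists>R. \<forall>r\<in>{0..1}. rcut R r = A r"
  proof (rule fuzzy_of_levels[of A])
    fix r :: real assume r: "0 < r" "r \<le> 1"
    show "compact (A r)" using comp r by simp
    have "A r = (\<Union>x\<in>rcut P r. \<Union>y\<in>rcut Q r. {x + y})" by (auto simp: A_def)
    then show "convex (A r)" using r(1) by (simp add: convex_sums rcut_convex)
    fix x assume x: "\<And>s. 0 < s \<Longrightarrow> s < r \<Longrightarrow> x \<in> A s"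
    define s where "s n = r * (1 - inverse (real (Suc (Suc n))))" for n
    have s: "0 < s n" "s n < r" for n
    proof -
      have "0 < inverse (real (Suc (Suc n)))" "inverse (real (Suc (Suc n))) < 1"
        by (simp_all add: field_simps)
      then show "0 < s n" "s n < r" using r by (simp_all add: s_def)
    qed
    have smono: "s m \<le> s n" if "m \<le> n" for m n
      unfolding s_def using r that by (intro mult_left_mono diff_left_mono le_imp_inverse_le) auto
    have slim: "s \<longlonglongrightarrow> r"
      unfolding s_def
      using tendsto_mult_left[OF tendsto_diff[OF tendsto_const LIMSEQ_Suc[OF LIMSEQ_inverse_real_of_nat]],
          of r 1] by simp
    have "\<forall>n. \<exists>a. a \<in> rcut P (s n) \<and> x - a \<in> rcut Q (s n)"
      
    proof
      fix n
      obtain a b where "x = a + b" "a \<in> rcut P (s n)" "b \<in> rcut Q (s n)"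
        using x[OF s, of n] unfolding A_def by blast
      then show "\<exists>a. a \<in> rcut P (s n) \<and> x - a \<in> rcut Q (s n)" by (intro exI[of _ a]) simp
    qed
    then obtain a where a: "\<And>n. a n \<in> rcut P (s n)" "\<And>n. x - a n \<in> rcut Q (s n)" by metis
    have "a n \<in> rcut P 0" for n using a(1) rcut_subset_0[OF s(1)] by blast
    then obtain l k where k: "strict_mono (k :: nat \<Rightarrow> nat)" "(a \<circ> k) \<longlonglongrightarrow> l"

    proof -
      have "seq_compact (rcut P 0)" using rcut_compact[of 0 P] by (simp add: compact_eq_seq_compact_metric)
      moreover have "\<forall>n. a n \<in> rcut P 0" using \<open>\<And>n. a n \<in> rcut P 0\<close> by blast
      ultimately show thesis using that by (metis seq_compactE)
    qed
    have in1: "l \<in> rcut P (s n)" "x - l \<in> rcut Q (s n)" for n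
    proof -
      have *: "\<forall>\<^sub>F m in sequentially. n \<le> k m"
        using eventually_ge_at_top[of n] by eventually_elim (use seq_suble[OF k(1)] in \<open>meson order_trans\<close>)
      have "\<forall>\<^sub>F m in sequentially. (a \<circ> k) m \<in> rcut P (s n)"
        using * by eventually_elim (use a(1) rcut_mono[OF s(1) smono] in \<open>simp, blast\<close>)
      moreover have "closed (rcut P (s n))" by (intro compact_imp_closed rcut_compact less_imp_le s(1))
      ultimately show "l \<in> rcut P (s n)" by (intro Lim_in_closed_set[OF _ _ sequentially_bot k(2)])
      have "\<forall>\<^sub>F m in sequentially. x - (a \<circ> k) m \<in> rcut Q (s n)"
        using * by eventually_elim (use a(2) rcut_mono[OF s(1) smono] in \<open>simp, blast\<close>)
      moreover have "closed (rcut Q (s n))" by (intro compact_imp_closed rcut_compact less_imp_le s(1))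
      moreover have "(\<lambda>m. x - (a \<circ> k) m) \<longlonglongrightarrow> x - l" using k(2) by (intro tendsto_intros)
      ultimately show "x - l \<in> rcut Q (s n)"
        by (intro Lim_in_closed_set[of _ "\<lambda>m. x - (a \<circ> k) m", OF _ _ sequentially_bot])
    qed
    have "r \<le> memb P l" "r \<le> memb Q (x - l)"
    proof -
      have "s n \<le> memb P l" "s n \<le> memb Q (x - l)" for n
        using in1[of n] s(1)[of n] by (simp_all add: rcut_def)
      then show "r \<le> memb P l" "r \<le> memb Q (x - l)"
        using LIMSEQ_le_const2[OF slim] by blast+
    qed
    then have "l \<in> rcut P r" "x - l \<in> rcut Q r" using r by (simp_all add: rcut_def)
    then show "x \<in> A r" unfolding A_def
      by (intro CollectI exI[of _ l] exI[of _ "x - l"]) simp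
  next
    show "A 1 \<noteq> {}" using rcut_nonempty[of 1 P] rcut_nonempty[of 1 Q] by (auto simp: A_def)
  next
    fix r s :: real assume "0 < s" "s \<le> r"
    then show "A r \<subseteq> A s" using rcut_mono[of s r] unfolding A_def by blast
  next
    show "bounded (A 0)" using comp compact_imp_bounded by auto
  qed (rule z)
  then obtain R where R: "\<forall>r\<in>{0..1}. rcut R r = A r" by blast
  have "\<forall>r\<in>{0..1}. rcut (P \<oplus>\<^sub>f Q) r = A r"
    unfolding fadd_def A_def
    by (rule theI[of _ R]) (use R in \<open>simp_all add: A_def fuzzy_eqI\<close>)
  then show ?thesis using assms by (simp add: A_def)
qed

lemma rcut_fscale:
  assumes "0 \<le> r" "r \<le> 1"
  shows "rcut (c \<cdot>\<^sub>f P) r = (\<lambda>x. c * x) ` rcut P r"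
proof -
  define A where "A r = (\<lambda>x. c * x) ` rcut P r" for r
  have comp: "compact (A r)" if "0 \<le> r" for r
    unfolding A_def by (intro compact_continuous_image rcut_compact that continuous_intros)
  have "\<exists>R. \<forall>r\<in>{0..1}. rcut R r = A r"
  proof (rule fuzzy_of_levels[of A])
    fix r :: real assume r: "0 < r" "r \<le> 1"
    show "compact (A r)" using comp r by simp
    show "convex (A r)" unfolding A_def using rcut_convex[of r P] r convex_scaling[of "rcut P r" c]
      by simp
    fix x assume x: "\<And>s. 0 < s \<Longrightarrow> s < r \<Longrightarrow> x \<in> A s"
    show "x \<in> A r"
    proof (cases "c = 0")
      case True
      then have "x = 0" using x[of "r/2"] r by (auto simp: A_def)
      then show ?thesis using True rcut_nonempty[of r P] r by (auto simp: A_def)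
    next
      case False
      have mem: "x \<in> A s \<longleftrightarrow> x / c \<in> rcut P s" for s
      proof
        assume "x / c \<in> rcut P s"
        then have "c * (x / c) \<in> A s" unfolding A_def by (rule imageI)
        then show "x \<in> A s" using False by simp
      qed (use False in \<open>auto simp: A_def\<close>)
      have "s \<le> memb P (x / c)" if "0 < s" "s < r" for s
        using x[OF that] that(1) by (simp add: mem rcut_def)
      then have "r \<le> memb P (x / c)" by (rule dense_le_bounded[OF r(1)])
      then show ?thesis using r by (simp add: mem rcut_def)
    qed
  next
    show "A 1 \<noteq> {}" using rcut_nonempty[of 1 P] rcut_nonempty[of 1 Q] by (auto simp: A_def)
  next
    fix r s :: real assume "0 < s" "s \<le> r"
    then show "A r \<subseteq> A s" using rcut_mono[of s r] unfolding A_def by blast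
  next
    show "bounded (A 0)" using comp compact_imp_bounded by auto
  next
    have "(\<Union>r\<in>{0<..1}. A r) = (\<lambda>x. c *\<^sub>R x) ` (\<Union>r\<in>{0<..1}. rcut P r)"
      by (auto simp: A_def)
    then show "A 0 = closure (\<Union>r\<in>{0<..1}. A r)"
      using closure_scaleR[of c "\<Union>r\<in>{0<..1}. rcut P r"] by (simp add: A_def rcut_0_eq)
  qed
  then obtain R where R: "\<forall>r\<in>{0..1}. rcut R r = A r" by blast
  have "\<forall>r\<in>{0..1}. rcut (c \<cdot>\<^sub>f P) r = A r"
    unfolding fscale_def A_def
    by (rule theI[of _ R]) (use R in \<open>simp_all add: A_def fuzzy_eqI\<close>)
  then show ?thesis using assms by (simp add: A_def)
qed


section \<open>Triangular fuzzy numbers\<close>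

definition is_triangular :: "fuzzy \<Rightarrow> real \<Rightarrow> real \<Rightarrow> real \<Rightarrow> bool" where
  "is_triangular P p1 p2 p3 \<longleftrightarrow>
     p1 \<le> p2 \<and> p2 \<le> p3 \<and>
     (\<forall>r\<in>{0..1}. rcut P r = {p1 + r * (p2 - p1) .. p3 - r * (p3 - p2)})"

definition triangular :: "fuzzy set" ("\<Omega>") where
  "\<Omega> = {P. \<exists>p1 p2 p3. is_triangular P p1 p2 p3}"

definition comp1 :: "fuzzy \<Rightarrow> real" where
  "comp1 P = (THE p1. \<exists>p2 p3. is_triangular P p1 p2 p3)"

definition comp2 :: "fuzzy \<Rightarrow> real" where
  "comp2 P = (THE p2. \<exists>p1 p3. is_triangular P p1 p2 p3)"

definition comp3 :: "fuzzy \<Rightarrow> real" where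
  "comp3 P = (THE p3. \<exists>p1 p2. is_triangular P p1 p2 p3)"

lemma is_triangular_unique:
  assumes "is_triangular P p1 p2 p3" "is_triangular P q1 q2 q3"
  shows "p1 = q1" "p2 = q2" "p3 = q3"
proof -
  have "{p1 + r * (p2 - p1) .. p3 - r * (p3 - p2)} = {q1 + r * (q2 - q1) .. q3 - r * (q3 - q2)}"
    if "r \<in> {0..1}" for r
    using assms that by (simp add: is_triangular_def)
  from this[of 0] this[of 1] have "{p1..p3} = {q1..q3}" "{p2..p2} = {q2..q2}" by simp_all
  moreover have "p1 \<le> p3" using assms by (simp add: is_triangular_def)
  ultimately show "p1 = q1" "p2 = q2" "p3 = q3" by (simp_all only: Icc_eq_Icc) auto
qed

lemma comp_triangular:
  assumes "is_triangular P p1 p2 p3"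
  shows "comp1 P = p1" "comp2 P = p2" "comp3 P = p3"
proof -
  show "comp1 P = p1" unfolding comp1_def
    by (rule the_equality) (use assms is_triangular_unique(1) in blast)+
  show "comp2 P = p2" unfolding comp2_def
    by (rule the_equality) (use assms is_triangular_unique(2) in blast)+
  show "comp3 P = p3" unfolding comp3_def
    by (rule the_equality) (use assms is_triangular_unique(3) in blast)+
qed

lemma triangular_exists:
  assumes "p1 \<le> p2" "p2 \<le> p3"
  shows "\<exists>!P. is_triangular P p1 p2 p3"
proof -
  define A where "A r = {p1 + r * (p2 - p1) .. p3 - r * (p3 - p2)}" for r
  have A0: "A r \<subseteq> A s" if "0 \<le> s" "s \<le> r" for r s
  proof -
    have "s * (p2 - p1) \<le> r * (p2 - p1)" "s * (p3 - p2) \<le> r * (p3 - p2)"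
      using assms that by (simp_all add: mult_right_mono)
    then show ?thesis by (auto simp: A_def)
  qed
  have "\<exists>P. \<forall>r\<in>{0..1}. rcut P r = A r"
  proof (rule fuzzy_of_levels[of A])
    fix r x :: real assume r: "0 < r" "r \<le> 1" and x: "\<And>s. 0 < s \<Longrightarrow> s < r \<Longrightarrow> x \<in> A s"
    have ev: "\<forall>\<^sub>F s in at_left r. 0 < s \<and> s < r"
      using eventually_at_left_real[OF r(1)] by (auto elim: eventually_mono)
    have "p1 + r * (p2 - p1) \<le> x"
    proof (rule tendsto_upperbound)
      show "((\<lambda>s. p1 + s * (p2 - p1)) \<longlongrightarrow> p1 + r * (p2 - p1)) (at_left r)"
        by (intro tendsto_intros)
      show "\<forall>\<^sub>F s in at_left r. p1 + s * (p2 - p1) \<le> x"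
        using ev by eventually_elim (use x in \<open>auto simp: A_def\<close>)
    qed simp
    moreover have "x \<le> p3 - r * (p3 - p2)"
    proof (rule tendsto_lowerbound)
      show "((\<lambda>s. p3 - s * (p3 - p2)) \<longlongrightarrow> p3 - r * (p3 - p2)) (at_left r)"
        by (intro tendsto_intros)
      show "\<forall>\<^sub>F s in at_left r. x \<le> p3 - s * (p3 - p2)"
        using ev by eventually_elim (use x in \<open>auto simp: A_def\<close>)
    qed simp
    ultimately show "x \<in> A r" by (simp add: A_def)
  next
    show "A 0 = closure (\<Union>r\<in>{0<..1}. A r)"
    proof
      show "closure (\<Union>r\<in>{0<..1}. A r) \<subseteq> A 0"
        proof (rule closure_minimal)
        show "closed (A 0)" by (simp add: A_def)
        show "(\<Union>r\<in>{0<..1}. A r) \<subseteq> A 0" by (rule UN_least) (rule A0, simp_all)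
      qed
    next
      show "A 0 \<subseteq> closure (\<Union>r\<in>{0<..1}. A r)"
      proof
        fix x assume "x \<in> A 0"
        then have x: "p1 \<le> x" "x \<le> p3" by (auto simp: A_def)
        define f where "f n = x + inverse (real (Suc n)) * (p2 - x)" for n
        have "f n \<in> (\<Union>r\<in>{0<..1}. A r)" for n
        proof
          let ?r = "inverse (real (Suc n))"
          show "?r \<in> {0<..1}" by (simp add: field_simps)
          then have "(1 - ?r) * p1 \<le> (1 - ?r) * x" "(1 - ?r) * x \<le> (1 - ?r) * p3"
            using x by (auto intro!: mult_left_mono)
          then show "f n \<in> A ?r" by (simp only: f_def A_def atLeastAtMost_iff) argo
        qed
        moreover have "f \<longlonglongrightarrow> x" unfolding f_def
          using tendsto_add[OF tendsto_const tendsto_mult_right[OF LIMSEQ_inverse_real_of_nat],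
              of x "p2 - x"] by simp
        ultimately show "x \<in> closure (\<Union>r\<in>{0<..1}. A r)"
          unfolding closure_sequential by (intro exI[of _ f] conjI allI)
      qed
    qed
  qed (use assms A0 in \<open>auto simp: A_def\<close>)
  then obtain P where P: "\<forall>r\<in>{0..1}. rcut P r = A r" by blast
  have "is_triangular P p1 p2 p3" using assms P by (simp add: is_triangular_def A_def)
  then show ?thesis
    by (rule ex1I) (use P in \<open>auto simp: is_triangular_def A_def intro!: fuzzy_eqI\<close>)
qed


section \<open>Generalized Hukuhara difference and conformable derivatives\<close>

definition is_gH_diff :: "fuzzy \<Rightarrow> fuzzy \<Rightarrow> fuzzy \<Rightarrow> bool" where
  "is_gH_diff P Q R \<longleftrightarrow> P = Q \<oplus>\<^sub>f R \<or> Q = P \<oplus>\<^sub>f ((-1) \<cdot>\<^sub>f R)"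

definition gH_diff_exists :: "fuzzy \<Rightarrow> fuzzy \<Rightarrow> bool" where
  "gH_diff_exists P Q \<longleftrightarrow> (\<exists>R. is_gH_diff P Q R)"

definition gH_diff :: "fuzzy \<Rightarrow> fuzzy \<Rightarrow> fuzzy" (infixl "\<ominus>\<^sub>g\<^sub>H" 65) where
  "P \<ominus>\<^sub>g\<^sub>H Q = (THE R. is_gH_diff P Q R)"

lemma is_gH_diff_unique:
  assumes "is_gH_diff P Q R" "is_gH_diff P Q R'"
  shows "R = R'"
proof (rule fuzzy_eqI)
  have Icc: "\<exists>a b. a \<le> b \<and> rcut X r = {a..b}" if "0 < r" "r \<le> 1" for X r
  proof -
    have "is_interval (rcut X r)" "compact (rcut X r)" "rcut X r \<noteq> {}"
      using that rcut_compact rcut_convex rcut_nonempty by (auto simp: is_interval_convex_1)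
    then show ?thesis
      using connected_compact_interval_1[of "rcut X r"] is_interval_connected by fastforce
  qed
  have sum: "{x + y |x y. x \<in> {a..b} \<and> y \<in> {c..d}} = {a + c .. b + d}"
    if "a \<le> b" "c \<le> d" for a b c d :: real
  proof safe
    fix z assume z: "z \<in> {a + c .. b + d}"
    show "\<exists>x y. z = x + y \<and> x \<in> {a..b} \<and> y \<in> {c..d}"
      using that z by (intro exI[of _ "min b (z - c)"] exI[of _ "z - min b (z - c)"]) (auto simp: min_def)
  qed auto
  fix r :: real assume r: "0 < r" "r \<le> 1"
  obtain p1 p2 where p: "p1 \<le> p2" "rcut P r = {p1..p2}" using Icc[OF r] by blast
  obtain q1 q2 where q: "q1 \<le> q2" "rcut Q r = {q1..q2}" using Icc[OF r] by blast
  have "(\<exists>a b. rcut X r = {a..b} \<and> a \<le> b \<and>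
           ((p1 = q1 + a \<and> p2 = q2 + b) \<or> (q1 = p1 - b \<and> q2 = p2 - a)))"
    if X: "is_gH_diff P Q X" for X
  proof -
    obtain a b where ab: "a \<le> b" "rcut X r = {a..b}" using Icc[OF r] by blast
    have m: "rcut ((- 1) \<cdot>\<^sub>f X) r = {-b..-a}"
      using r ab by (simp add: rcut_fscale)
    have "{p1..p2} = {q1 + a..q2 + b} \<or> {q1..q2} = {p1 + - b..p2 + - a}"
      using X unfolding is_gH_diff_def
    proof
      assume "P = Q \<oplus>\<^sub>f X"
      then have "rcut P r = {x + y |x y. x \<in> rcut Q r \<and> y \<in> rcut X r}"
        using r by (simp add: rcut_fadd)
      then show ?thesis using sum[OF q(1) ab(1)] by (simp add: p(2) q(2) ab(2))
    next
      assume "Q = P \<oplus>\<^sub>f (- 1) \<cdot>\<^sub>f X"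
      then have "rcut Q r = {x + y |x y. x \<in> rcut P r \<and> y \<in> rcut ((- 1) \<cdot>\<^sub>f X) r}"
        using r by (simp add: rcut_fadd)
      then show ?thesis using sum[OF p(1), of "-b" "-a"] ab(1) m by (simp add: p(2) q(2) m)
    qed
    then have "(p1 = q1 + a \<and> p2 = q2 + b) \<or> (q1 = p1 - b \<and> q2 = p2 - a)"
      using p(1) q(1) by (simp only: Icc_eq_Icc) auto
    then show ?thesis using ab by blast
  qed
  note * = this
  obtain a b where ab: "rcut R r = {a..b}" "a \<le> b"
    "(p1 = q1 + a \<and> p2 = q2 + b) \<or> (q1 = p1 - b \<and> q2 = p2 - a)"
    using *[OF assms(1)] by blast
  obtain c d where cd: "rcut R' r = {c..d}" "c \<le> d"
    "(p1 = q1 + c \<and> p2 = q2 + d) \<or> (q1 = p1 - d \<and> q2 = p2 - c)"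
    using *[OF assms(2)] by blast
  have "a = c \<and> b = d" using ab(2,3) cd(2,3) by linarith
  then show "rcut R r = rcut R' r" using ab(1) cd(1) by simp
qed

text \<open>The standing assumption on gH-differences, for the differences entering the
  \<open>\<alpha>\<close>-derivative of \<open>w\<close> at \<open>\<tau>\<close>; since these only enter through the limit
  \<open>\<epsilon> \<rightarrow> 0\<close>, it is required for all sufficiently small \<open>\<epsilon> \<noteq> 0\<close>.\<close>

definition gH_standing :: "real \<Rightarrow> (real \<Rightarrow> fuzzy) \<Rightarrow> real \<Rightarrow> bool" where
  "gH_standing \<alpha> w \<tau> \<longleftrightarrow>
     (\<forall>\<^sub>F \<epsilon> in at 0. gH_diff_exists (w (\<tau> + \<epsilon> * \<tau> powr (1 - \<alpha>))) (w \<tau>) \<and>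
                    w (\<tau> + \<epsilon> * \<tau> powr (1 - \<alpha>)) \<ominus>\<^sub>g\<^sub>H w \<tau> \<in> \<Omega>)"

text \<open>\<open>L\<close> is the limit, in the metric \<open>fdist\<close>, of the gH-difference quotients. That
  the quotients are defined for small \<open>\<epsilon> \<noteq> 0\<close> is part of the limit existing; for
  \<open>\<tau> > 0\<close> the point \<open>\<tau> + \<epsilon> \<tau>\<^sup>1\<^sup>-\<^sup>\<alpha>\<close> lies in \<open>[0,\<infinity>)\<close> for small \<open>\<epsilon>\<close>.\<close>

definition has_gH_deriv :: "real \<Rightarrow> (real \<Rightarrow> fuzzy) \<Rightarrow> real \<Rightarrow> fuzzy \<Rightarrow> bool" where
  "has_gH_deriv \<alpha> w \<tau> L \<longleftrightarrow>
     (\<forall>\<^sub>F \<epsilon> in at 0. gH_diff_exists (w (\<tau> + \<epsilon> * \<tau> powr (1 - \<alpha>))) (w \<tau>)) \<and>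
     ((\<lambda>\<epsilon>. fdist ((1 / \<epsilon>) \<cdot>\<^sub>f (w (\<tau> + \<epsilon> * \<tau> powr (1 - \<alpha>)) \<ominus>\<^sub>g\<^sub>H w \<tau>)) L) \<longlongrightarrow> 0) (at 0)"

definition gH_differentiable :: "real \<Rightarrow> (real \<Rightarrow> fuzzy) \<Rightarrow> real \<Rightarrow> bool" where
  "gH_differentiable \<alpha> w \<tau> \<longleftrightarrow> (\<exists>L. has_gH_deriv \<alpha> w \<tau> L)"

definition gH_deriv :: "real \<Rightarrow> (real \<Rightarrow> fuzzy) \<Rightarrow> real \<Rightarrow> fuzzy" where
  "gH_deriv \<alpha> w \<tau> = (THE L. has_gH_deriv \<alpha> w \<tau> L)"

definition conf_quotient :: "real \<Rightarrow> (real \<Rightarrow> real) \<Rightarrow> real \<Rightarrow> real \<Rightarrow> real" where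
  "conf_quotient \<alpha> f \<tau> \<epsilon> = (f (\<tau> + \<epsilon> * \<tau> powr (1 - \<alpha>)) - f \<tau>) / \<epsilon>"

definition conf_differentiable :: "real \<Rightarrow> (real \<Rightarrow> real) \<Rightarrow> real \<Rightarrow> bool" where
  "conf_differentiable \<alpha> f \<tau> \<longleftrightarrow> (\<exists>d. (conf_quotient \<alpha> f \<tau> \<longlongrightarrow> d) (at 0))"

definition conf_deriv :: "real \<Rightarrow> (real \<Rightarrow> real) \<Rightarrow> real \<Rightarrow> real" where
  "conf_deriv \<alpha> f \<tau> = Lim (at 0) (conf_quotient \<alpha> f \<tau>)"

definition comps_conf_differentiable :: "real \<Rightarrow> (real \<Rightarrow> fuzzy) \<Rightarrow> real \<Rightarrow> bool" where
  "comps_conf_differentiable \<alpha> w \<tau> \<longleftrightarrow>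
     conf_differentiable \<alpha> (\<lambda>t. comp1 (w t)) \<tau> \<and>
     conf_differentiable \<alpha> (\<lambda>t. comp2 (w t)) \<tau> \<and>
     conf_differentiable \<alpha> (\<lambda>t. comp3 (w t)) \<tau>"

text \<open>At a point of either kind of differentiability, the derivative of that kind is
  \<^const>\<open>gH_deriv\<close> itself; only the order of the components differs.
  \<^const>\<open>is_triangular\<close> includes the ordering of the three conformable derivatives.\<close>

definition i_gH_differentiable :: "real \<Rightarrow> (real \<Rightarrow> fuzzy) \<Rightarrow> real \<Rightarrow> bool" where
  "i_gH_differentiable \<alpha> w \<tau> \<longleftrightarrow>
     gH_differentiable \<alpha> w \<tau> \<and> comps_conf_differentiable \<alpha> w \<tau> \<and>
     is_triangular (gH_deriv \<alpha> w \<tau>)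
       (conf_deriv \<alpha> (\<lambda>t. comp1 (w t)) \<tau>)
       (conf_deriv \<alpha> (\<lambda>t. comp2 (w t)) \<tau>)
       (conf_deriv \<alpha> (\<lambda>t. comp3 (w t)) \<tau>)"

definition ii_gH_differentiable :: "real \<Rightarrow> (real \<Rightarrow> fuzzy) \<Rightarrow> real \<Rightarrow> bool" where
  "ii_gH_differentiable \<alpha> w \<tau> \<longleftrightarrow>
     gH_differentiable \<alpha> w \<tau> \<and> comps_conf_differentiable \<alpha> w \<tau> \<and>
     is_triangular (gH_deriv \<alpha> w \<tau>)
       (conf_deriv \<alpha> (\<lambda>t. comp3 (w t)) \<tau>)
       (conf_deriv \<alpha> (\<lambda>t. comp2 (w t)) \<tau>)
       (conf_deriv \<alpha> (\<lambda>t. comp1 (w t)) \<tau>)"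

end

theory Submission
  imports Defs
begin

text \<open>
  The idea is to describe gH-difference quotients of triangular fuzzy numbers by a formula that does
  not depend on which of the two alternatives in the definition of the gH-difference occurs.
  If \<open>P\<close>, \<open>Q\<close> and \<open>P \<ominus>\<^sub>g\<^sub>H Q\<close> are triangular, the gH-difference has the components
  \<open>p\<^sub>i - q\<^sub>i\<close>, with the outer two interchanged in the second alternative. As its components are
  ordered, the outer ones are the minimum and the maximum of \<open>p\<^sub>1 - q\<^sub>1\<close> and \<open>p\<^sub>3 - q\<^sub>3\<close>
  in both cases (\<open>is_triangular_gH_diff\<close>). Multiplication by \<open>1 / \<epsilon>\<close> preserves this
  description for either sign of \<open>\<epsilon>\<close>.

  Since minimum and maximum are continuous, conformable differentiability of the three components of
  a triangular-valued function, with derivatives \<open>d\<^sub>i\<close>, together with the existence of triangular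
  gH-differences forces the gH-derivative to be \<open>(min d\<^sub>1 d\<^sub>3, d\<^sub>2, max d\<^sub>1 d\<^sub>3)\<close>
  (\<open>has_gH_deriv_triangularI\<close>). The components of \<open>w \<oplus>\<^sub>f \<nu>\<close> are the sums of those of
  \<open>w\<close> and \<open>\<nu>\<close>, so their derivatives add up. If the component derivatives of both functions
  are ordered increasingly, so are those of the sum, which gives the first claim; if both are ordered
  decreasingly, so are those of the sum, which gives the second.
\<close>

section \<open>Level sets and the Hausdorff metric\<close>

lemma rcut_eq_Icc:
  assumes "0 \<le> r" "r \<le> 1"
  shows "rcut P r = {lower P r .. upper P r}"
proof -
  have "connected (rcut P r)" "compact (rcut P r)" "rcut P r \<noteq> {}"
    using assms rcut_compact rcut_convex rcut_nonempty by (auto intro: convex_connected)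
  moreover from this obtain a b where ab: "rcut P r = {a..b}"
    using connected_compact_interval_1[of "rcut P r"] by auto
  ultimately have "a \<le> b" by simp
  then show ?thesis using ab by (simp add: lower_def upper_def)
qed

lemma lower_upper_mem:
  assumes "0 \<le> r" "r \<le> 1"
  shows "lower P r \<in> rcut P r" "upper P r \<in> rcut P r"
  using rcut_eq_Icc[OF assms, of P] rcut_nonempty[OF assms, of P] by auto

lemma level_distance_le_fdist:
  assumes "0 \<le> r" "r \<le> 1"
  shows "max \<bar>lower P r - lower Q r\<bar> \<bar>upper P r - upper Q r\<bar> \<le> fdist P Q"
proof -
  \<comment> \<open>All level sets lie in the compact \<open>0\<close>-cuts, so the supremum is a genuine one.\<close>
  obtain M N where M: "\<And>x. x \<in> rcut P 0 \<Longrightarrow> \<bar>x\<bar> \<le> M"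
    and N: "\<And>x. x \<in> rcut Q 0 \<Longrightarrow> \<bar>x\<bar> \<le> N"
    using compact_imp_bounded[OF rcut_compact[of 0]] unfolding bounded_iff real_norm_def
    by (metis order_refl)
  have sub: "rcut X s \<subseteq> rcut X 0" if "0 \<le> s" for X s
    using that rcut_subset_0[of s X] by (cases "s = 0") auto
  have "max \<bar>lower P s - lower Q s\<bar> \<bar>upper P s - upper Q s\<bar> \<le> M + N"
    if "s \<in> {0..1}" for s
  proof -
    have s: "0 \<le> s" "s \<le> 1" using that by auto
    have "\<bar>lower P s\<bar> \<le> M" "\<bar>upper P s\<bar> \<le> M" "\<bar>lower Q s\<bar> \<le> N" "\<bar>upper Q s\<bar> \<le> N"
      using lower_upper_mem[OF s] sub[OF s(1)] M N by blast+
    then show ?thesis by linarith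
  qed
  then have "bdd_above ((\<lambda>r. max \<bar>lower P r - lower Q r\<bar> \<bar>upper P r - upper Q r\<bar>) ` {0..1})"
    by (rule bdd_aboveI2)
  then show ?thesis unfolding fdist_def by (rule cSUP_upper2) (use assms in auto)
qed

lemma fdist_nonneg: "0 \<le> fdist P Q"
  using level_distance_le_fdist[of 0 P Q] by linarith

lemma fdist_limit_unique:
  assumes "((\<lambda>x. fdist (X x) L) \<longlongrightarrow> 0) F" "((\<lambda>x. fdist (X x) L') \<longlongrightarrow> 0) F" "F \<noteq> bot"
  shows "L = L'"
proof (rule fuzzy_eqI)
  fix r :: real assume r: "0 < r" "r \<le> 1"
  have lim: "((\<lambda>x. fdist (X x) L + fdist (X x) L') \<longlongrightarrow> 0) F"
    using tendsto_add[OF assms(1,2)] by simp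
  have "max \<bar>lower L r - lower L' r\<bar> \<bar>upper L r - upper L' r\<bar>
          \<le> fdist (X x) L + fdist (X x) L'" for x
    using level_distance_le_fdist[of r "X x" L] level_distance_le_fdist[of r "X x" L'] r by linarith
  then have "max \<bar>lower L r - lower L' r\<bar> \<bar>upper L r - upper L' r\<bar> \<le> 0"
    by (intro tendsto_lowerbound[OF lim _ assms(3)] always_eventually) simp
  then have "lower L r = lower L' r" "upper L r = upper L' r" by linarith+
  then show "rcut L r = rcut L' r" using r by (simp add: rcut_eq_Icc)
qed

lemma gH_deriv_eq:
  assumes "has_gH_deriv \<alpha> w \<tau> L"
  shows "gH_deriv \<alpha> w \<tau> = L"
  unfolding gH_deriv_def
proof (rule the_equality)
  show "has_gH_deriv \<alpha> w \<tau> L" by (rule assms)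
  show "L' = L" if "has_gH_deriv \<alpha> w \<tau> L'" for L'
    using that assms unfolding has_gH_deriv_def
    by (elim conjE) (rule fdist_limit_unique[OF _ _ at_neq_bot])
qed


section \<open>Arithmetic of triangular fuzzy numbers\<close>

lemma is_triangularD:
  assumes "is_triangular P p1 p2 p3" "0 \<le> r" "r \<le> 1"
  shows "rcut P r = {p1 + r * (p2 - p1) .. p3 - r * (p3 - p2)}"
    and "p1 + r * (p2 - p1) \<le> p3 - r * (p3 - p2)"
proof -
  show eq: "rcut P r = {p1 + r * (p2 - p1) .. p3 - r * (p3 - p2)}"
    using assms by (simp add: is_triangular_def)
  show "p1 + r * (p2 - p1) \<le> p3 - r * (p3 - p2)"
    using rcut_nonempty[OF assms(2,3), of P] by (simp add: eq)
qed

lemma Icc_sumset: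
  fixes a b c d :: real
  assumes "a \<le> b" "c \<le> d"
  shows "{x + y |x y. x \<in> {a..b} \<and> y \<in> {c..d}} = {a + c .. b + d}"
proof safe
  fix z assume "z \<in> {a + c .. b + d}"
  then show "\<exists>x y. z = x + y \<and> x \<in> {a..b} \<and> y \<in> {c..d}"
    using assms
    by (intro exI[of _ "min b (z - c)"] exI[of _ "z - min b (z - c)"]) (auto simp: min_def)
qed auto

lemma scale_Icc:
  fixes a b c :: real
  assumes "a \<le> b"
  shows "(\<lambda>x. c * x) ` {a..b} = (if 0 \<le> c then {c * a .. c * b} else {c * b .. c * a})"
  using assms by (auto simp: image_mult_atLeastAtMost_if)

lemma is_triangular_fadd:
  assumes "is_triangular P p1 p2 p3" "is_triangular Q q1 q2 q3"
  shows "is_triangular (P \<oplus>\<^sub>f Q) (p1 + q1) (p2 + q2) (p3 + q3)"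
  unfolding is_triangular_def
proof (intro conjI ballI)
  fix r :: real assume "r \<in> {0..1}"
  then have r: "0 \<le> r" "r \<le> 1" by auto
  show "rcut (P \<oplus>\<^sub>f Q) r = {p1 + q1 + r * (p2 + q2 - (p1 + q1)) .. p3 + q3 - r * (p3 + q3 - (p2 + q2))}"
    unfolding rcut_fadd[OF r] is_triangularD(1)[OF assms(1) r] is_triangularD(1)[OF assms(2) r]
      Icc_sumset[OF is_triangularD(2)[OF assms(1) r] is_triangularD(2)[OF assms(2) r]]
    by (simp add: algebra_simps)
qed (use assms in \<open>auto simp: is_triangular_def intro: add_mono\<close>)

text \<open>A negative factor reverses the order of the components; minimum and maximum cover both signs.\<close>

lemma is_triangular_fscale:
  assumes P: "is_triangular P p1 p2 p3"
  shows "is_triangular (c \<cdot>\<^sub>f P) (min (c * p1) (c * p3)) (c * p2) (max (c * p1) (c * p3))"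
proof -
  have ord: "p1 \<le> p2" "p2 \<le> p3" using P by (simp_all add: is_triangular_def)
  show ?thesis
  proof (cases "0 \<le> c")
    case True
    then have c: "c * p1 \<le> c * p2" "c * p2 \<le> c * p3" using ord by (simp_all add: mult_left_mono)
    then have mm: "min (c * p1) (c * p3) = c * p1" "max (c * p1) (c * p3) = c * p3" by auto
    show ?thesis unfolding mm is_triangular_def
    proof (intro conjI ballI c)
      fix r :: real assume "r \<in> {0..1}"
      then have r: "0 \<le> r" "r \<le> 1" by auto
      show "rcut (c \<cdot>\<^sub>f P) r = {c * p1 + r * (c * p2 - c * p1) .. c * p3 - r * (c * p3 - c * p2)}"
        unfolding rcut_fscale[OF r] is_triangularD(1)[OF P r]
        using True is_triangularD(2)[OF P r]
        by (simp only: scale_Icc if_True if_False) (simp add: algebra_simps)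
    qed
  next
    case False
    then have c: "c * p3 \<le> c * p2" "c * p2 \<le> c * p1" using ord by (simp_all add: mult_left_mono_neg)
    then have mm: "min (c * p1) (c * p3) = c * p3" "max (c * p1) (c * p3) = c * p1" by auto
    show ?thesis unfolding mm is_triangular_def
    proof (intro conjI ballI c)
      fix r :: real assume "r \<in> {0..1}"
      then have r: "0 \<le> r" "r \<le> 1" by auto
      show "rcut (c \<cdot>\<^sub>f P) r = {c * p3 + r * (c * p2 - c * p3) .. c * p1 - r * (c * p1 - c * p2)}"
        unfolding rcut_fscale[OF r] is_triangularD(1)[OF P r]
        using False is_triangularD(2)[OF P r]
        by (simp only: scale_Icc if_True if_False) (simp add: algebra_simps)
    qed
  qed
qed

lemma is_triangular_comps:
  assumes "P \<in> \<Omega>"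
  shows "is_triangular P (comp1 P) (comp2 P) (comp3 P)"
proof -
  obtain p1 p2 p3 where "is_triangular P p1 p2 p3" using assms by (auto simp: triangular_def)
  then show ?thesis by (simp add: comp_triangular)
qed

lemma comp_fadd:
  assumes "P \<in> \<Omega>" "Q \<in> \<Omega>"
  shows "comp1 (P \<oplus>\<^sub>f Q) = comp1 P + comp1 Q"
    and "comp2 (P \<oplus>\<^sub>f Q) = comp2 P + comp2 Q"
    and "comp3 (P \<oplus>\<^sub>f Q) = comp3 P + comp3 Q"
  using comp_triangular[OF is_triangular_fadd[OF is_triangular_comps is_triangular_comps]] assms
  by auto

lemma triangular_fadd: "P \<in> \<Omega> \<Longrightarrow> Q \<in> \<Omega> \<Longrightarrow> P \<oplus>\<^sub>f Q \<in> \<Omega>"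
  unfolding triangular_def by (blast intro: is_triangular_fadd)

text \<open>The two alternatives for the gH-difference give the same three numbers \<open>p\<^sub>i - q\<^sub>i\<close>, read
  in opposite orders. Because only the increasing reading is a triangular fuzzy number, the outer
  components need not be told apart.\<close>

lemma is_triangular_gH_diff:
  assumes P: "is_triangular P p1 p2 p3" and Q: "is_triangular Q q1 q2 q3"
    and ex: "gH_diff_exists P Q" and mem: "P \<ominus>\<^sub>g\<^sub>H Q \<in> \<Omega>"
  shows "is_triangular (P \<ominus>\<^sub>g\<^sub>H Q) (min (p1 - q1) (p3 - q3)) (p2 - q2) (max (p1 - q1) (p3 - q3))"
proof -
  define R where "R = P \<ominus>\<^sub>g\<^sub>H Q"
  have "\<exists>!R. is_gH_diff P Q R"
    using ex is_gH_diff_unique unfolding gH_diff_exists_def by blast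
  from theI'[OF this] have diff: "is_gH_diff P Q R" by (simp add: R_def gH_diff_def)
  obtain r1 r2 r3 where R: "is_triangular R r1 r2 r3"
    using mem by (auto simp: R_def triangular_def)
  then have ord: "r1 \<le> r2" "r2 \<le> r3" by (simp_all add: is_triangular_def)
  consider "P = Q \<oplus>\<^sub>f R" | "Q = P \<oplus>\<^sub>f ((-1) \<cdot>\<^sub>f R)"
    using diff by (auto simp: is_gH_diff_def)
  then have "r1 = min (p1 - q1) (p3 - q3) \<and> r2 = p2 - q2 \<and> r3 = max (p1 - q1) (p3 - q3)"
  proof cases
    case 1
    then show ?thesis
      using is_triangular_unique[OF P] is_triangular_fadd[OF Q R] ord by force
  next
    case 2
    have "is_triangular ((-1) \<cdot>\<^sub>f R) (- r3) (- r2) (- r1)"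
      using is_triangular_fscale[OF R, of "-1"] ord by (simp add: min_absorb2 max_absorb1)
    then have "is_triangular Q (p1 + - r3) (p2 + - r2) (p3 + - r1)"
      unfolding 2 by (rule is_triangular_fadd[OF P])
    then show ?thesis using is_triangular_unique[OF Q] ord by force
  qed
  then show ?thesis using R by (simp add: R_def)
qed

text \<open>The end points of the level sets are convex combinations of the components, so the
  componentwise distance controls every level at once.\<close>

lemma fdist_triangular_le:
  assumes P: "is_triangular P p1 p2 p3" and Q: "is_triangular Q q1 q2 q3"
  shows "fdist P Q \<le> \<bar>p1 - q1\<bar> + \<bar>p2 - q2\<bar> + \<bar>p3 - q3\<bar>"
  unfolding fdist_def
proof (rule cSUP_least)
  fix r :: real assume "r \<in> {0..1}"
  then have r: "0 \<le> r" "r \<le> 1" by auto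
  have comb: "\<bar>(1 - r) * a + r * b\<bar> \<le> \<bar>a\<bar> + \<bar>b\<bar>" for a b :: real
  proof -
    have "(1 - r) * \<bar>a\<bar> \<le> 1 * \<bar>a\<bar>" "r * \<bar>b\<bar> \<le> 1 * \<bar>b\<bar>" using r by (intro mult_right_mono; simp)+
    then show ?thesis
      using abs_triangle_ineq[of "(1 - r) * a" "r * b"] r by (simp add: abs_mult)
  qed
  have l: "lower P r - lower Q r = (1 - r) * (p1 - q1) + r * (p2 - q2)"
    unfolding lower_def is_triangularD(1)[OF P r] is_triangularD(1)[OF Q r]
    using is_triangularD(2)[OF P r] is_triangularD(2)[OF Q r]
    by simp (simp add: algebra_simps)
  have u: "upper P r - upper Q r = (1 - r) * (p3 - q3) + r * (p2 - q2)"
    unfolding upper_def is_triangularD(1)[OF P r] is_triangularD(1)[OF Q r]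
    using is_triangularD(2)[OF P r] is_triangularD(2)[OF Q r]
    by simp (simp add: algebra_simps)
  show "max \<bar>lower P r - lower Q r\<bar> \<bar>upper P r - upper Q r\<bar>
          \<le> \<bar>p1 - q1\<bar> + \<bar>p2 - q2\<bar> + \<bar>p3 - q3\<bar>"
    unfolding l u using comb[of "p1 - q1" "p2 - q2"] comb[of "p3 - q3" "p2 - q2"] by linarith
qed simp


section \<open>Derivatives of triangular-valued functions\<close>

lemma eventually_conformable_point_nonneg:
  fixes \<alpha> \<tau> :: real
  assumes "0 < \<tau>"
  shows "\<forall>\<^sub>F \<epsilon> in at 0. 0 \<le> \<tau> + \<epsilon> * \<tau> powr (1 - \<alpha>)"
proof -
  have "((\<lambda>\<epsilon>. \<tau> + \<epsilon> * \<tau> powr (1 - \<alpha>)) \<longlongrightarrow> \<tau> + 0 * \<tau> powr (1 - \<alpha>)) (at 0)"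
    by (intro tendsto_intros)
  then have "((\<lambda>\<epsilon>. \<tau> + \<epsilon> * \<tau> powr (1 - \<alpha>)) \<longlongrightarrow> \<tau>) (at 0)" by simp
  from order_tendstoD(1)[OF this assms]
  show ?thesis by eventually_elim simp
qed

lemma conf_differentiable_iff:
  "conf_differentiable \<alpha> f \<tau> \<longleftrightarrow> (conf_quotient \<alpha> f \<tau> \<longlongrightarrow> conf_deriv \<alpha> f \<tau>) (at 0)"
  unfolding conf_differentiable_def conf_deriv_def by (auto simp: tendsto_Lim)

lemma conf_deriv_eq:
  "(conf_quotient \<alpha> f \<tau> \<longlongrightarrow> d) (at 0) \<Longrightarrow> conf_deriv \<alpha> f \<tau> = d"
  unfolding conf_deriv_def by (simp add: tendsto_Lim)

lemma conf_deriv_sum: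
  assumes "0 < \<tau>" and h: "\<And>t. 0 \<le> t \<Longrightarrow> h t = f t + g t"
    and f: "conf_differentiable \<alpha> f \<tau>" and g: "conf_differentiable \<alpha> g \<tau>"
  shows "conf_differentiable \<alpha> h \<tau>" "conf_deriv \<alpha> h \<tau> = conf_deriv \<alpha> f \<tau> + conf_deriv \<alpha> g \<tau>"
proof -
  have ev: "\<forall>\<^sub>F \<epsilon> in at 0. conf_quotient \<alpha> f \<tau> \<epsilon> + conf_quotient \<alpha> g \<tau> \<epsilon> = conf_quotient \<alpha> h \<tau> \<epsilon>"
    using eventually_conformable_point_nonneg[OF assms(1), of \<alpha>]
  proof eventually_elim
    case (elim \<epsilon>)
    then show ?case
      using assms(1) by (simp add: conf_quotient_def h diff_divide_distrib add_divide_distrib)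
  qed
  have lim: "(conf_quotient \<alpha> h \<tau> \<longlongrightarrow> conf_deriv \<alpha> f \<tau> + conf_deriv \<alpha> g \<tau>) (at 0)"
    using f g unfolding conf_differentiable_iff
    by (intro Lim_transform_eventually[OF tendsto_add ev])
  then show "conf_differentiable \<alpha> h \<tau>" by (auto simp: conf_differentiable_def)
  show "conf_deriv \<alpha> h \<tau> = conf_deriv \<alpha> f \<tau> + conf_deriv \<alpha> g \<tau>" by (rule conf_deriv_eq[OF lim])
qed

text \<open>A gH-difference quotient has the conformable quotients of the components as its components, up
  to order. The kind of gH-difference and the sign of \<open>\<epsilon>\<close> may vary along \<open>\<epsilon> \<rightarrow> 0\<close>, but minimum
  and maximum absorb the variation and pass to the limit.\<close>

lemma has_gH_deriv_triangularI:
  assumes "0 < \<tau>" "w \<in> {0..} \<rightarrow> \<Omega>" "gH_standing \<alpha> w \<tau>" "comps_conf_differentiable \<alpha> w \<tau>"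
    and L: "is_triangular L
       (min (conf_deriv \<alpha> (\<lambda>t. comp1 (w t)) \<tau>) (conf_deriv \<alpha> (\<lambda>t. comp3 (w t)) \<tau>))
       (conf_deriv \<alpha> (\<lambda>t. comp2 (w t)) \<tau>)
       (max (conf_deriv \<alpha> (\<lambda>t. comp1 (w t)) \<tau>) (conf_deriv \<alpha> (\<lambda>t. comp3 (w t)) \<tau>))"
      (is "is_triangular L (min ?d1 ?d3) ?d2 (max ?d1 ?d3)")
  shows "has_gH_deriv \<alpha> w \<tau> L"
  unfolding has_gH_deriv_def
proof
  let ?p = "\<lambda>\<epsilon>. \<tau> + \<epsilon> * \<tau> powr (1 - \<alpha>)"
  let ?X = "\<lambda>\<epsilon>. (1 / \<epsilon>) \<cdot>\<^sub>f (w (?p \<epsilon>) \<ominus>\<^sub>g\<^sub>H w \<tau>)"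
  define q1 where "q1 = conf_quotient \<alpha> (\<lambda>t. comp1 (w t)) \<tau>"
  define q2 where "q2 = conf_quotient \<alpha> (\<lambda>t. comp2 (w t)) \<tau>"
  define q3 where "q3 = conf_quotient \<alpha> (\<lambda>t. comp3 (w t)) \<tau>"
  note st = assms(3)[unfolded gH_standing_def]
  show "\<forall>\<^sub>F \<epsilon> in at 0. gH_diff_exists (w (?p \<epsilon>)) (w \<tau>)"
    using st by eventually_elim simp
  have tri: "\<forall>\<^sub>F \<epsilon> in at 0. is_triangular (?X \<epsilon>) (min (q1 \<epsilon>) (q3 \<epsilon>)) (q2 \<epsilon>) (max (q1 \<epsilon>) (q3 \<epsilon>))"
    using st eventually_conformable_point_nonneg[OF assms(1), of \<alpha>]
  proof eventually_elim
    case (elim \<epsilon>)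
    have mm: "min (c * min a b) (c * max a b) = min (c * a) (c * b)"
      "max (c * min a b) (c * max a b) = max (c * a) (c * b)" for a b c :: real
      by (auto simp: min_def max_def)
    have "w (?p \<epsilon>) \<in> \<Omega>" "w \<tau> \<in> \<Omega>" using assms(1,2) elim by auto
    then have "is_triangular (w (?p \<epsilon>) \<ominus>\<^sub>g\<^sub>H w \<tau>)
        (min (comp1 (w (?p \<epsilon>)) - comp1 (w \<tau>)) (comp3 (w (?p \<epsilon>)) - comp3 (w \<tau>)))
        (comp2 (w (?p \<epsilon>)) - comp2 (w \<tau>))
        (max (comp1 (w (?p \<epsilon>)) - comp1 (w \<tau>)) (comp3 (w (?p \<epsilon>)) - comp3 (w \<tau>)))"
      using elim by (intro is_triangular_gH_diff is_triangular_comps) auto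
    from is_triangular_fscale[OF this, of "1 / \<epsilon>"] show ?case
      unfolding mm by (simp add: q1_def q2_def q3_def conf_quotient_def)
  qed
  have "(q1 \<longlongrightarrow> ?d1) (at 0)" "(q2 \<longlongrightarrow> ?d2) (at 0)" "(q3 \<longlongrightarrow> ?d3) (at 0)"
    using assms(4) unfolding comps_conf_differentiable_def conf_differentiable_iff
    by (simp_all add: q1_def q2_def q3_def)
  then have "((\<lambda>\<epsilon>. \<bar>min (q1 \<epsilon>) (q3 \<epsilon>) - min ?d1 ?d3\<bar> + \<bar>q2 \<epsilon> - ?d2\<bar>
                 + \<bar>max (q1 \<epsilon>) (q3 \<epsilon>) - max ?d1 ?d3\<bar>) \<longlongrightarrow>
        \<bar>min ?d1 ?d3 - min ?d1 ?d3\<bar> + \<bar>?d2 - ?d2\<bar> + \<bar>max ?d1 ?d3 - max ?d1 ?d3\<bar>) (at 0)"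
    by (intro tendsto_intros)
  then have bound: "((\<lambda>\<epsilon>. \<bar>min (q1 \<epsilon>) (q3 \<epsilon>) - min ?d1 ?d3\<bar> + \<bar>q2 \<epsilon> - ?d2\<bar>
                 + \<bar>max (q1 \<epsilon>) (q3 \<epsilon>) - max ?d1 ?d3\<bar>) \<longlongrightarrow> 0) (at 0)" by simp
  show "((\<lambda>\<epsilon>. fdist (?X \<epsilon>) L) \<longlongrightarrow> 0) (at 0)"
  proof (rule tendsto_sandwich[OF _ _ tendsto_const bound])
    show "\<forall>\<^sub>F \<epsilon> in at 0. 0 \<le> fdist (?X \<epsilon>) L" by (simp add: fdist_nonneg)
    show "\<forall>\<^sub>F \<epsilon> in at 0. fdist (?X \<epsilon>) L \<le> \<bar>min (q1 \<epsilon>) (q3 \<epsilon>) - min ?d1 ?d3\<bar> + \<bar>q2 \<epsilon> - ?d2\<bar>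
                 + \<bar>max (q1 \<epsilon>) (q3 \<epsilon>) - max ?d1 ?d3\<bar>"
      using tri by eventually_elim (rule fdist_triangular_le[OF _ L])
  qed
qed

theorem lemma3p1:
  fixes \<alpha> \<tau> :: real and w \<nu> :: "real \<Rightarrow> fuzzy"
  assumes "0 < \<alpha>" and "\<alpha> \<le> 1" and "0 < \<tau>"
    and "w \<in> {0..} \<rightarrow> \<Omega>" and "\<nu> \<in> {0..} \<rightarrow> \<Omega>"
    and "gH_standing \<alpha> w \<tau>" and "gH_standing \<alpha> \<nu> \<tau>"
    and "gH_standing \<alpha> (\<lambda>t. w t \<oplus>\<^sub>f \<nu> t) \<tau>"
    and "gH_differentiable \<alpha> w \<tau>" and "gH_differentiable \<alpha> \<nu> \<tau>"
  shows "(i_gH_differentiable \<alpha> w \<tau> \<and> i_gH_differentiable \<alpha> \<nu> \<tau> \<longrightarrow>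
            i_gH_differentiable \<alpha> (\<lambda>t. w t \<oplus>\<^sub>f \<nu> t) \<tau> \<and>
            gH_deriv \<alpha> (\<lambda>t. w t \<oplus>\<^sub>f \<nu> t) \<tau> = gH_deriv \<alpha> w \<tau> \<oplus>\<^sub>f gH_deriv \<alpha> \<nu> \<tau>) \<and>
         (ii_gH_differentiable \<alpha> w \<tau> \<and> ii_gH_differentiable \<alpha> \<nu> \<tau> \<longrightarrow>
            ii_gH_differentiable \<alpha> (\<lambda>t. w t \<oplus>\<^sub>f \<nu> t) \<tau> \<and>
            gH_deriv \<alpha> (\<lambda>t. w t \<oplus>\<^sub>f \<nu> t) \<tau> = gH_deriv \<alpha> w \<tau> \<oplus>\<^sub>f gH_deriv \<alpha> \<nu> \<tau>)"
proof -
  let ?s = "\<lambda>t. w t \<oplus>\<^sub>f \<nu> t"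
  let ?d = "\<lambda>c u. conf_deriv \<alpha> (\<lambda>t. c (u t)) \<tau>"
  have s_tri: "?s \<in> {0..} \<rightarrow> \<Omega>" using assms(4,5) by (auto intro: triangular_fadd)
  have comps: "comps_conf_differentiable \<alpha> ?s \<tau> \<and> ?d comp1 ?s = ?d comp1 w + ?d comp1 \<nu> \<and>
      ?d comp2 ?s = ?d comp2 w + ?d comp2 \<nu> \<and> ?d comp3 ?s = ?d comp3 w + ?d comp3 \<nu>"
    if "comps_conf_differentiable \<alpha> w \<tau>" "comps_conf_differentiable \<alpha> \<nu> \<tau>"
  proof -
    have add: "comp1 (?s t) = comp1 (w t) + comp1 (\<nu> t)"
      "comp2 (?s t) = comp2 (w t) + comp2 (\<nu> t)"
      "comp3 (?s t) = comp3 (w t) + comp3 (\<nu> t)" if "0 \<le> t" for t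
      using assms(4,5) that by (auto intro!: comp_fadd)
    show ?thesis
      using that conf_deriv_sum[OF assms(3) add(1)] conf_deriv_sum[OF assms(3) add(2)]
        conf_deriv_sum[OF assms(3) add(3)]
      unfolding comps_conf_differentiable_def by auto
  qed
  note derivI = has_gH_deriv_triangularI[OF assms(3) s_tri assms(8)]
  show ?thesis
  proof (intro conjI impI; elim conjE)
    assume i: "i_gH_differentiable \<alpha> w \<tau>" "i_gH_differentiable \<alpha> \<nu> \<tau>"
    then have c: "comps_conf_differentiable \<alpha> ?s \<tau>" "?d comp1 ?s = ?d comp1 w + ?d comp1 \<nu>"
      "?d comp2 ?s = ?d comp2 w + ?d comp2 \<nu>" "?d comp3 ?s = ?d comp3 w + ?d comp3 \<nu>"
      using comps by (auto simp: i_gH_differentiable_def)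
    have tri: "is_triangular (gH_deriv \<alpha> w \<tau> \<oplus>\<^sub>f gH_deriv \<alpha> \<nu> \<tau>) (?d comp1 ?s) (?d comp2 ?s) (?d comp3 ?s)"
      unfolding c using i by (intro is_triangular_fadd) (auto simp: i_gH_differentiable_def)
    then have "?d comp1 ?s \<le> ?d comp3 ?s" by (simp add: is_triangular_def)
    then have D: "has_gH_deriv \<alpha> ?s \<tau> (gH_deriv \<alpha> w \<tau> \<oplus>\<^sub>f gH_deriv \<alpha> \<nu> \<tau>)"
      using tri by (intro derivI c(1)) (simp add: min_absorb1 max_absorb2)
    show eq: "gH_deriv \<alpha> ?s \<tau> = gH_deriv \<alpha> w \<tau> \<oplus>\<^sub>f gH_deriv \<alpha> \<nu> \<tau>" by (rule gH_deriv_eq[OF D])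
    show "i_gH_differentiable \<alpha> ?s \<tau>"
      unfolding i_gH_differentiable_def gH_differentiable_def eq using D c(1) tri by blast
  next
    assume ii: "ii_gH_differentiable \<alpha> w \<tau>" "ii_gH_differentiable \<alpha> \<nu> \<tau>"
    then have c: "comps_conf_differentiable \<alpha> ?s \<tau>" "?d comp1 ?s = ?d comp1 w + ?d comp1 \<nu>"
      "?d comp2 ?s = ?d comp2 w + ?d comp2 \<nu>" "?d comp3 ?s = ?d comp3 w + ?d comp3 \<nu>"
      using comps by (auto simp: ii_gH_differentiable_def)
    have tri: "is_triangular (gH_deriv \<alpha> w \<tau> \<oplus>\<^sub>f gH_deriv \<alpha> \<nu> \<tau>) (?d comp3 ?s) (?d comp2 ?s) (?d comp1 ?s)"
      unfolding c using ii by (intro is_triangular_fadd) (auto simp: ii_gH_differentiable_def)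
    then have "?d comp3 ?s \<le> ?d comp1 ?s" by (simp add: is_triangular_def)
    then have D: "has_gH_deriv \<alpha> ?s \<tau> (gH_deriv \<alpha> w \<tau> \<oplus>\<^sub>f gH_deriv \<alpha> \<nu> \<tau>)"
      using tri by (intro derivI c(1)) (simp add: min_absorb2 max_absorb1)
    show eq: "gH_deriv \<alpha> ?s \<tau> = gH_deriv \<alpha> w \<tau> \<oplus>\<^sub>f gH_deriv \<alpha> \<nu> \<tau>" by (rule gH_deriv_eq[OF D])
    show "ii_gH_differentiable \<alpha> ?s \<tau>"
      unfolding ii_gH_differentiable_def gH_differentiable_def eq using D c(1) tri by blast
  qed
qed

end
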